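(* Let $V\subset\mathbb{R}^n$ be a closed convex cone and let a $0$-minimal pair $(A,B)\in\mathcal{C}_V^2(\mathbb{R}^n)$ have the property of translation. Then the following assertions hold: (a) The set $\{(A-x,B-x)\mid x\in B_*\}$ is the set of all $0$-minimal pairs of the class $[A,B]$. (b) For $x\in B$: $x\in B_*$ if and only if $B\cap(x-V)=x+L_V$. (c) $B=B_*+V$.
   Context: $\mathcal{C}_V(\mathbb{R}^n)$ is the family of all nonempty closed convex sets $A\subset\mathbb{R}^n$ whose recession cone $\{x\in\mathbb{R}^n \mid x+A\subset A\}$ equals $V$; $\mathcal{C}_V^2(\mathbb{R}^n)=\mathcal{C}_V(\mathbb{R}^n)\times\mathcal{C}_V(\mathbb{R}^n)$. Sums are Minkowski sums. Pairs $(A,B),(C,D)\in\mathcal{C}_V^2(\mathbb{R}^n)$ are equivalent if $A+D=B+C$; this is an equivalence relation and $[A,B]$ denotes the class (a set of pairs) of $(A,B)$. Pairs are ordered by $(A_1,B_1)\prec(A_2,B_2)$ iff $A_1\subset A_2$ and $B_1\subset B_2$. A pair $(A,B)$ is $0$-minimal if it is a minimal element (with respect to $\prec$) of $\{(C,D)\in[A,B]\mid 0\in D\}$ (in particular $0\in B$). A translate of $(A,B)$ is a pair $(A-x,B-x)$ with $x\in\mathbb{R}^n$. A pair has the property of translation if any two $0$-minimal pairs in $[A,B]$ are translates of each other. The kernel of minimality of $(A,B)$ is $B_*=\{x\in B\mid (A-x,B-x)\text{ is }0\text{-minimal}\}$. $L_V=V\cap(-V)$ is the subspace of lineality of $V$.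 *)

theory Defs
  imports "HOL-Analysis.Analysis"
begin

definition recession_cone :: "(real ^ 'n) set \<Rightarrow> (real ^ 'n) set" where
  "recession_cone A = {x. (+) x ` A \<subseteq> A}"

text \<open>The family C_V of nonempty closed convex sets with recession cone \<open>V\<close>.\<close>

definition convex_family :: "(real ^ 'n) set \<Rightarrow> (real ^ 'n) set set" where
  "convex_family V = {A. A \<noteq> {} \<and> closed A \<and> convex A \<and> recession_cone A = V}"

type_synonym 'n set_pair = "(real ^ 'n) set \<times> (real ^ 'n) set"

text \<open>\<open>A + D\<close> is the Minkowski sum of sets from \<^theory>\<open>HOL-Library.Set_Algebras\<close>.\<close>

definition pair_rel :: "(real ^ 'n) set \<Rightarrow> ('n set_pair \<times> 'n set_pair) set" where
  "pair_rel V = {((A, B), (C, D)).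
     (A, B) \<in> convex_family V \<times> convex_family V \<and>
     (C, D) \<in> convex_family V \<times> convex_family V \<and>
     A + D = B + C}"

definition pair_class :: "(real ^ 'n) set \<Rightarrow> 'n set_pair \<Rightarrow> 'n set_pair set" where
  "pair_class V P = pair_rel V `` {P}"

text \<open>The order \<open>\<le>\<close> on pairs of sets is the componentwise one of
  \<^theory>\<open>HOL-Library.Product_Order\<close>, that is, inclusion in both components.\<close>

definition zero_minimal :: "(real ^ 'n) set \<Rightarrow> 'n set_pair \<Rightarrow> bool" where
  "zero_minimal V P \<longleftrightarrow>
     (let S = {(C, D). (C, D) \<in> pair_class V P \<and> 0 \<in> D}
      in P \<in> S \<and> (\<forall>Q\<in>S. Q \<le> P \<longrightarrow> Q = P))"

text \<open>The translate of \<open>(A, B)\<close> by \<open>x\<close> is \<open>(A - x, B - x)\<close>; note the sign.\<close>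

definition translate_pair :: "real ^ 'n \<Rightarrow> 'n set_pair \<Rightarrow> 'n set_pair" where
  "translate_pair x P = ((\<lambda>a. a - x) ` fst P, (\<lambda>b. b - x) ` snd P)"

definition translation_property :: "(real ^ 'n) set \<Rightarrow> 'n set_pair \<Rightarrow> bool" where
  "translation_property V P \<longleftrightarrow>
     (\<forall>Q\<in>pair_class V P. \<forall>R\<in>pair_class V P.
        zero_minimal V Q \<longrightarrow> zero_minimal V R \<longrightarrow> (\<exists>x. R = translate_pair x Q))"

definition minimality_kernel :: "(real ^ 'n) set \<Rightarrow> 'n set_pair \<Rightarrow> (real ^ 'n) set" where
  "minimality_kernel V P = {x \<in> snd P. zero_minimal V (translate_pair x P)}"

definition lineality_space :: "(real ^ 'n) set \<Rightarrow> (real ^ 'n) set" where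
  "lineality_space V = V \<inter> uminus ` V"

end

theory Submission
  imports Defs
begin

text \<open>
  Every translate \<open>(A - x, B - x)\<close> is equivalent to \<open>(A, B)\<close>, and it has \<open>0\<close> in its second set
  exactly if \<open>x \<in> B\<close>; this and the property of translation give (a).

  Assertions (b) and (c) both come down to one existence statement: below every pair
  \<open>(C, D)\<close> with \<open>0 \<in> D\<close> there is a \<open>0\<close>-minimal pair of the same class
  (\<open>exists_zero_minimal\<close>).  Apply it to \<open>(A - x, B - x)\<close> with \<open>x \<in> B\<close>.  By the property of
  translation the minimal pair found is \<open>(A - y, B - y)\<close> for some \<open>y\<close>, which lies in \<open>B\<^sub>*\<close>, and
  \<open>B - y \<subseteq> B - x\<close> says that \<open>x - y\<close> is a recession direction of \<open>B\<close>, so \<open>x \<in> B\<^sub>* + V\<close>.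
  This is (c), and also the hard half of (b): if moreover \<open>B\<close> meets \<open>x - V\<close> only in \<open>x + L\<^sub>V\<close>, then
  \<open>y \<in> x + L\<^sub>V\<close>, and translating by an element of \<open>L\<^sub>V\<close> changes neither \<open>A\<close> nor \<open>B\<close>.
  For the other half let \<open>x \<in> B\<^sub>*\<close> and \<open>y \<in> B\<close> with \<open>x - y \<in> V\<close>.  Then \<open>(A - y, B - y)\<close> lies below
  the minimal pair \<open>(A - x, B - x)\<close>, so the two are equal, and \<open>y - x\<close> is a recession direction too.

  The minimal pair comes from Zorn's lemma, the lower bound of a chain being the componentwise
  intersection.  Two facts make this work.

  \<^item> Minkowski addition of a fixed set commutes with the intersection of a chain
    (\<open>Inter_chain_plus\<close>), so that the intersection stays in the class.
  \<^item> The order cancellation law \<open>X + D \<subseteq> Y + D \<Longrightarrow> X \<subseteq> Y\<close> (\<open>order_cancellation\<close>) makes the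
    relation on pairs transitive, once the family is known to be closed under sums
    (\<open>convex_family_plus\<close>); hence a pair minimal below \<open>(C, D)\<close> in the class of
    \<open>(C, D)\<close> is also minimal in its own class.

  The sets involved are unbounded, and both facts are proved by compactness.  The compactness
  needed is that of \<open>D \<inter> (x - Y) \<inter> L\<^sub>V\<^sup>\<bottom>\<close> for \<open>D\<close> and \<open>Y\<close> with recession cone \<open>V\<close>
  (\<open>compact_slice\<close>): a direction in which this set is unbounded belongs to \<open>V\<close>, to \<open>-V\<close> and to
  \<open>L\<^sub>V\<^sup>\<bottom>\<close>, hence vanishes.  Since every member of the family is invariant under \<open>L\<^sub>V\<close>, cutting with
  \<open>L\<^sub>V\<^sup>\<bottom>\<close> loses nothing.
\<close>

section \<open>Recession cones of closed convex sets\<close>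

lemma recession_coneD:
  assumes "v \<in> recession_cone S" and "s \<in> S"
  shows "v + s \<in> S"
  using assms by (auto simp: recession_cone_def)

text \<open>For \<open>b \<in> S\<close> the convex combinations \<open>(1 - t\<^sub>n) b + t\<^sub>n s\<^sub>n\<close> tend to \<open>b + v\<close>, which
  therefore lies in \<open>S\<close>.\<close>

lemma asymptotic_direction_in_recession_cone:
  fixes S :: "(real ^ 'n) set"
  assumes "closed S" and "convex S"
    and s: "\<And>n. s n \<in> S" and t: "\<And>n. 0 \<le> t n" "t \<longlonglongrightarrow> 0"
    and lim: "(\<lambda>n. t n *\<^sub>R s n) \<longlonglongrightarrow> v"
  shows "v \<in> recession_cone S"
  unfolding recession_cone_def
proof (intro CollectI image_subsetI)
  fix b assume b: "b \<in> S"
  have "(\<lambda>n. (1 - t n) *\<^sub>R b + t n *\<^sub>R s n) \<longlonglongrightarrow> (1 - 0) *\<^sub>R b + v"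
    by (intro tendsto_intros t lim)
  then have *: "(\<lambda>n. (1 - t n) *\<^sub>R b + t n *\<^sub>R s n) \<longlonglongrightarrow> v + b"
    by (simp add: add.commute)
  have "eventually (\<lambda>n. t n < 1) sequentially"
    using t(2) by (rule order_tendstoD) simp
  then have "eventually (\<lambda>n. (1 - t n) *\<^sub>R b + t n *\<^sub>R s n \<in> S) sequentially"
    by (rule eventually_mono) (use \<open>convex S\<close> b s t(1) in \<open>auto intro!: convexD\<close>)
  with \<open>closed S\<close> * show "v + b \<in> S"
    by (intro Lim_in_closed_set[of S _ sequentially]) auto
qed

lemma recession_cone_translate:
  "recession_cone ((\<lambda>a. a - x) ` S) = recession_cone S"
  unfolding recession_cone_def
  by (auto simp: image_subset_iff image_iff algebra_simps)

lemma convex_family_translate: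
  assumes "S \<in> convex_family V"
  shows "(\<lambda>a. a - x) ` S \<in> convex_family V"
  using assms closed_translation_subtract[of S x]
  by (simp add: convex_family_def recession_cone_translate)

text \<open>A recession direction of the intersection is one of each member \<open>S\<close>, because a single ray
  \<open>a + n v\<close> in \<open>S\<close> already makes \<open>v\<close> an asymptotic direction of \<open>S\<close>.\<close>

lemma Inter_in_convex_family:
  fixes \<F> :: "(real ^ 'n) set set"
  assumes fam: "\<F> \<subseteq> convex_family V" and "\<F> \<noteq> {}" and "\<Inter>\<F> \<noteq> {}"
  shows "\<Inter>\<F> \<in> convex_family V"
proof -
  have rec: "recession_cone S = V" "closed S" "convex S" if "S \<in> \<F>" for S
    using fam that by (auto simp: convex_family_def)
  obtain a where a: "a \<in> \<Inter>\<F>" using \<open>\<Inter>\<F> \<noteq> {}\<close> by blast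
  have "recession_cone (\<Inter>\<F>) = V"
  proof
    show "V \<subseteq> recession_cone (\<Inter>\<F>)"
    proof
      fix v assume "v \<in> V"
      then have "v + s \<in> S" if "S \<in> \<F>" "s \<in> S" for S s
        using rec(1)[OF that(1)] recession_coneD that(2) by blast
      then show "v \<in> recession_cone (\<Inter>\<F>)" by (auto simp: recession_cone_def)
    qed
  next
    show "recession_cone (\<Inter>\<F>) \<subseteq> V"
    proof
      fix v assume v: "v \<in> recession_cone (\<Inter>\<F>)"
      have ray: "a + real n *\<^sub>R v \<in> \<Inter>\<F>" for n
      proof (induction n)
        case (Suc n)
        from recession_coneD[OF v Suc.IH] show ?case by (simp add: algebra_simps)
      qed (use a in simp)
      obtain S where S: "S \<in> \<F>" using \<open>\<F> \<noteq> {}\<close> by blast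
      have "(\<lambda>n. inverse (real (Suc n)) *\<^sub>R a + v) \<longlonglongrightarrow> 0 *\<^sub>R a + v"
        by (intro tendsto_intros LIMSEQ_inverse_real_of_nat)
      then have lim: "(\<lambda>n. inverse (real (Suc n)) *\<^sub>R (a + real (Suc n) *\<^sub>R v)) \<longlonglongrightarrow> v"
        by (simp add: scaleR_add_right del: of_nat_Suc)
      have "v \<in> recession_cone S"
        by (rule asymptotic_direction_in_recession_cone
              [OF rec(2,3)[OF S] _ _ LIMSEQ_inverse_real_of_nat lim])
          (use ray S in blast, simp)
      then show "v \<in> V" using rec(1)[OF S] by simp
    qed
  qed
  moreover have "closed (\<Inter>\<F>)" "convex (\<Inter>\<F>)"
    using rec by (auto intro: closed_Inter convex_Inter)
  ultimately show ?thesis using \<open>\<Inter>\<F> \<noteq> {}\<close> by (simp add: convex_family_def)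
qed

section \<open>Compactness modulo the lineality space\<close>

lemma subspace_lineality_space:
  assumes "convex_cone V"
  shows "subspace (lineality_space V)"
proof (rule subspaceI)
  note V = assms[unfolded convex_cone_iff]
  have iff: "l \<in> lineality_space V \<longleftrightarrow> l \<in> V \<and> - l \<in> V" for l
    by (auto simp: lineality_space_def image_iff) (metis minus_minus)
  show "0 \<in> lineality_space V" using V by (simp add: iff)
  show "a + b \<in> lineality_space V"
    if "a \<in> lineality_space V" "b \<in> lineality_space V" for a b
    using V that unfolding iff by (metis minus_add_distrib)
  show "c *\<^sub>R a \<in> lineality_space V" if a: "a \<in> lineality_space V" for c a
  proof (cases "0 \<le> c")
    case True
    then show ?thesis using V a unfolding iff by (metis scaleR_minus_right)
  next
    case False
    then have "(- c) *\<^sub>R a \<in> V" "(- c) *\<^sub>R (- a) \<in> V"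
      using V a unfolding iff by (meson neg_0_le_iff_le nle_le)+
    then show ?thesis unfolding iff by simp
  qed
qed

lemma lineality_spaceD:
  assumes "l \<in> lineality_space V"
  shows "l \<in> V" "- l \<in> V"
  using assms by (auto simp: lineality_space_def)

text \<open>For \<open>K = {x}\<close> this is the part of \<open>D \<inter> (x - Y)\<close> orthogonal to the lineality space; it lists
  the first summands in the decompositions \<open>x = d + y\<close>, normalized modulo \<open>L\<^sub>V\<close>.  A set \<open>K\<close> in
  place of a point allows for decompositions of a convergent sequence of points.\<close>

definition slice ::
    "(real ^ 'n) set \<Rightarrow> (real ^ 'n) set \<Rightarrow> (real ^ 'n) set \<Rightarrow> (real ^ 'n) set \<Rightarrow> (real ^ 'n) set" where
  "slice V D Y K = D \<inter> {d. \<exists>k\<in>K. k - d \<in> Y} \<inter> (lineality_space V)\<^sup>\<bottom>"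

text \<open>If points \<open>d\<^sub>n\<close> of the slice had norms tending to infinity, a limit \<open>v\<close> of the normalized
  \<open>d\<^sub>n\<close> would be a unit vector.  It is a recession direction of \<open>D\<close>.  As \<open>K\<close> is
  bounded, \<open>-v\<close> is one of \<open>Y\<close>, so \<open>v \<in> L\<^sub>V\<close>; but \<open>v\<close> is also orthogonal to \<open>L\<^sub>V\<close>.\<close>

lemma compact_slice:
  assumes D: "D \<in> convex_family V" and Y: "Y \<in> convex_family V" and K: "compact K"
  shows "compact (slice V D Y K)"
proof -
  let ?K = "slice V D Y K"
  have D': "closed D" "convex D" "recession_cone D = V"
    and Y': "closed Y" "convex Y" "recession_cone Y = V"
    using D Y by (auto simp: convex_family_def)
  have closed_perp: "closed ((lineality_space V)\<^sup>\<bottom>)"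
    by (simp add: closed_subspace subspace_orthogonal_comp)
  have "(\<Union>k\<in>K. \<Union>y\<in>Y. {k - y}) = {d. \<exists>k\<in>K. k - d \<in> Y}"
    by (force simp: algebra_simps)
  with compact_closed_differences[OF K Y'(1)] have "closed {d. \<exists>k\<in>K. k - d \<in> Y}" by simp
  then have "closed ?K"
    unfolding slice_def using D'(1) closed_perp by (intro closed_Int)
  moreover have "bounded ?K"
  proof (rule ccontr)
    assume "\<not> bounded ?K"
    then have "\<exists>d\<in>?K. real n + 1 < norm d" for n :: nat
      unfolding bounded_iff by (meson not_le)
    then obtain d where d: "\<And>n. d n \<in> ?K" "\<And>n. real n + 1 < norm (d n)" by metis
    define t where "t n = inverse (norm (d n))" for n
    have d0: "0 < norm (d n)" for n using d(2)[of n] by linarith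
    have t_le: "t n \<le> inverse (real (Suc n))" for n
      unfolding t_def using d(2)[of n] by (intro le_imp_inverse_le) auto
    have t_nonneg: "0 \<le> t n" for n by (simp add: t_def)
    have t0: "t \<longlonglongrightarrow> 0"
      by (rule tendsto_sandwich[OF _ _ tendsto_const LIMSEQ_inverse_real_of_nat])
        (use t_le t_nonneg in auto)
    have "norm (t n *\<^sub>R d n) = 1" for n using d0[of n] by (simp add: t_def)
    then have unit: "\<forall>n. t n *\<^sub>R d n \<in> sphere 0 1" by simp
    obtain v r where v: "v \<in> sphere 0 1" and r: "strict_mono r"
      and lim: "((\<lambda>n. t n *\<^sub>R d n) \<circ> r) \<longlonglongrightarrow> v"
      by (rule seq_compactE[OF _ unit]) (simp add: compact_imp_seq_compact)
    have lim': "(\<lambda>n. t (r n) *\<^sub>R d (r n)) \<longlonglongrightarrow> v" using lim by (simp add: o_def)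
    have tr: "(\<lambda>n. t (r n)) \<longlonglongrightarrow> 0"
      using LIMSEQ_subseq_LIMSEQ[OF t0 r] by (simp add: o_def)
    have "v \<in> recession_cone D"
      by (rule asymptotic_direction_in_recession_cone[OF D'(1,2) _ _ tr lim'])
        (use d(1) t_nonneg in \<open>auto simp: slice_def\<close>)
    moreover have "- v \<in> recession_cone Y"
    proof -
      have "\<exists>k\<in>K. k - d (r n) \<in> Y" for n using d(1) by (auto simp: slice_def)
      then obtain x where x: "\<And>n. x n \<in> K" "\<And>n. x n - d (r n) \<in> Y" by metis
      obtain M where "\<And>k. k \<in> K \<Longrightarrow> norm k \<le> M"
        using compact_imp_bounded[OF K] by (auto simp: bounded_iff)
      then have "\<forall>n. norm (t (r n) *\<^sub>R x n) \<le> t (r n) * M"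
        using x(1) t_nonneg by (simp add: mult_left_mono)
      then have "(\<lambda>n. t (r n) *\<^sub>R x n) \<longlonglongrightarrow> 0"
        by (rule Lim_null_comparison[OF always_eventually tendsto_mult_left_zero[OF tr]])
      from tendsto_diff[OF this lim']
      have lim_y: "(\<lambda>n. t (r n) *\<^sub>R (x n - d (r n))) \<longlonglongrightarrow> - v"
        by (simp add: scaleR_diff_right)
      show ?thesis
        by (rule asymptotic_direction_in_recession_cone[OF Y'(1,2) x(2) _ tr lim_y])
          (simp add: t_nonneg)
    qed
    ultimately have "v \<in> lineality_space V"
      using D'(3) Y'(3) by (auto simp: lineality_space_def image_iff) (metis minus_minus)
    moreover have "v \<in> (lineality_space V)\<^sup>\<bottom>"
    proof (rule closed_sequentially[OF closed_perp _ lim'])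
      show "t (r n) *\<^sub>R d (r n) \<in> (lineality_space V)\<^sup>\<bottom>" for n
        using d(1) by (intro subspace_scale subspace_orthogonal_comp) (auto simp: slice_def)
    qed
    ultimately have "v = 0" by (auto simp: orthogonal_comp_def orthogonal_def)
    with v show False by simp
  qed
  ultimately show ?thesis by (simp add: compact_eq_bounded_closed)
qed

text \<open>Members of the family contain, with a point, its whole translate of \<open>L\<^sub>V\<close>, so a component
  along \<open>L\<^sub>V\<close> can be moved from one summand of a decomposition to the other.\<close>

lemma slice_nonempty:
  assumes "convex_cone V" and D: "D \<in> convex_family V" and Y: "Y \<in> convex_family V"
    and d: "d \<in> D" and y: "y \<in> Y"
  obtains d' where "d' \<in> slice V D Y {d + y}" "d - d' \<in> lineality_space V"
proof -
  obtain l d' where l: "l \<in> span (lineality_space V)"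
    and d': "\<And>w. w \<in> span (lineality_space V) \<Longrightarrow> orthogonal d' w" and eq: "d = l + d'"
    by (rule orthogonal_subspace_decomp_exists) auto
  have L: "span (lineality_space V) = lineality_space V"
    using subspace_lineality_space[OF assms(1)] by (simp add: span_eq_iff)
  have lV: "l \<in> recession_cone Y" "- l \<in> recession_cone D"
    using lineality_spaceD[of l V] l L D Y by (auto simp: convex_family_def)
  have "d - d' \<in> lineality_space V" using l L eq by simp
  moreover have "d' \<in> D" using recession_coneD[OF lV(2) d] eq by simp
  moreover have "d + y - d' \<in> Y" using recession_coneD[OF lV(1) y] eq by simp
  moreover have "d' \<in> (lineality_space V)\<^sup>\<bottom>"
    using d' L by (auto simp: orthogonal_comp_def orthogonal_commute)
  ultimately show thesis by (intro that) (simp_all add: slice_def)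
qed

section \<open>The order cancellation law and sums\<close>

text \<open>Both the cancellation law and the closure of the family under addition rest on this lemma.
  Up to a subsequence and up to shifts along \<open>L\<^sub>V\<close>, the displacements \<open>t\<^sub>n (d\<^sub>n - d\<^sub>0)\<close> converge:
  \<open>(1 - t\<^sub>n) d\<^sub>0 + t\<^sub>n d\<^sub>n\<close> and \<open>y\<^sub>n\<close> are points of \<open>D\<close> and \<open>Y\<close> with constant sum \<open>x + d\<^sub>0\<close>, so the
  former can be moved into one compact slice.  Because \<open>t\<^sub>n\<close> tends to \<open>0\<close>, the limit of the
  displacements is a recession direction, and \<open>Y\<close> absorbs it.\<close>

lemma shrinking_displacement:
  fixes D Y :: "(real ^ 'n) set"
  assumes V: "convex_cone V" and D: "D \<in> convex_family V" and Y: "Y \<in> convex_family V"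
    and d0: "d\<^sub>0 \<in> D" and d: "\<And>n. d n \<in> D" and y: "\<And>n. y n \<in> Y"
    and t: "\<And>n. 0 < t n" "\<And>n. t n \<le> 1" and t0: "t \<longlonglongrightarrow> 0"
    and eq: "\<And>n. x + t n *\<^sub>R d\<^sub>0 = y n + t n *\<^sub>R d n"
  shows "x \<in> Y"
proof -
  have D': "closed D" "convex D" "recession_cone D = V"
    and Y': "recession_cone Y = V"
    using D Y by (auto simp: convex_family_def)
  define e where "e n = (1 - t n) *\<^sub>R d\<^sub>0 + t n *\<^sub>R d n" for n
  have "e n \<in> D" for n
    unfolding e_def using D'(2) d0 d t less_imp_le[OF t(1)] by (intro convexD) auto
  moreover have sum: "e n + y n = x + d\<^sub>0" for n
    using eq[of n] by (simp add: e_def algebra_simps)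
  ultimately have "\<exists>f. f \<in> slice V D Y {x + d\<^sub>0} \<and> e n - f \<in> lineality_space V" for n
    by (metis slice_nonempty[OF V D Y _ y])
  then obtain f where f: "\<forall>n. f n \<in> slice V D Y {x + d\<^sub>0}"
    and ef: "\<And>n. e n - f n \<in> lineality_space V" by metis
  obtain l r where l: "l \<in> slice V D Y {x + d\<^sub>0}" and r: "strict_mono r"
    and lim: "(f \<circ> r) \<longlonglongrightarrow> l"
    by (rule seq_compactE[OF compact_imp_seq_compact[OF compact_slice[OF D Y]] f]) auto
  \<comment> \<open>The point of \<open>D\<close> whose convex combination with \<open>d\<^sub>0\<close> is \<open>f n\<close>.\<close>
  define s where "s n = d n - (1 / t n) *\<^sub>R (e n - f n)" for n
  have s: "s n \<in> D" for n
  proof -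
    have "- (1 / t n) *\<^sub>R (e n - f n) \<in> lineality_space V"
      by (intro subspace_scale subspace_lineality_space V ef)
    then have "- (1 / t n) *\<^sub>R (e n - f n) \<in> recession_cone D"
      using D'(3) lineality_spaceD(1) by blast
    from recession_coneD[OF this d] show ?thesis by (simp add: s_def)
  qed
  have ts: "t n *\<^sub>R s n = f n - (1 - t n) *\<^sub>R d\<^sub>0" for n
    using t(1)[of n] by (simp add: s_def e_def scaleR_diff_right)
  have tr: "(\<lambda>n. t (r n)) \<longlonglongrightarrow> 0"
    using LIMSEQ_subseq_LIMSEQ[OF t0 r] by (simp add: o_def)
  have "(\<lambda>n. f (r n) - (1 - t (r n)) *\<^sub>R d\<^sub>0) \<longlonglongrightarrow> l - (1 - 0) *\<^sub>R d\<^sub>0"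
    by (intro tendsto_intros tr) (use lim in \<open>simp add: o_def\<close>)
  then have lim': "(\<lambda>n. t (r n) *\<^sub>R s (r n)) \<longlonglongrightarrow> l - d\<^sub>0" by (simp add: ts)
  have "l - d\<^sub>0 \<in> recession_cone D"
    by (rule asymptotic_direction_in_recession_cone[OF D'(1,2) s _ tr lim'])
      (rule less_imp_le[OF t(1)])
  then have "l - d\<^sub>0 \<in> recession_cone Y" by (simp add: D' Y')
  moreover have "x + d\<^sub>0 - l \<in> Y" using l by (simp add: slice_def)
  ultimately have "l - d\<^sub>0 + (x + d\<^sub>0 - l) \<in> Y" by (rule recession_coneD)
  then show "x \<in> Y" by simp
qed

text \<open>Starting from some \<open>d\<^sub>0 \<in> D\<close>, write repeatedly \<open>x + d\<^sub>i = y\<^sub>i + d\<^sub>i\<^sub>+\<^sub>1\<close>.  Summing the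
  first \<open>n\<close> of these equations and dividing by \<open>n\<close> gives \<open>x + d\<^sub>0 / n = y + d\<^sub>n / n\<close>, where \<open>y \<in> Y\<close>
  is the mean of the \<open>y\<^sub>i\<close>; so \<open>x\<close> differs from points of \<open>Y\<close> by the shrinking displacements
  \<open>(d\<^sub>n - d\<^sub>0) / n\<close>.\<close>

lemma order_cancellation:
  fixes X Y D :: "(real ^ 'n) set"
  assumes V: "convex_cone V" and D: "D \<in> convex_family V" and Y: "Y \<in> convex_family V"
    and sub: "X + D \<subseteq> Y + D"
  shows "X \<subseteq> Y"
proof
  fix x assume x: "x \<in> X"
  have Y': "convex Y" and "D \<noteq> {}" using D Y by (auto simp: convex_family_def)
  then obtain d\<^sub>0 where d0: "d\<^sub>0 \<in> D" by blast
  have step: "\<exists>y\<in>Y. \<exists>d'\<in>D. x + d = y + d'" if "d \<in> D" for d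
  proof -
    have "x + d \<in> Y + D" using sub x that by blast
    then show ?thesis by (rule set_plus_elim) blast
  qed
  have mean: "\<exists>y\<in>Y. \<exists>d\<in>D. real (Suc n) *\<^sub>R x + d\<^sub>0 = real (Suc n) *\<^sub>R y + d" for n
  proof (induction n)
    case 0
    from step[OF d0] show ?case by simp
  next
    case (Suc n)
    then obtain y d where y: "y \<in> Y" and d: "d \<in> D"
      and eq: "real (Suc n) *\<^sub>R x + d\<^sub>0 = real (Suc n) *\<^sub>R y + d" by blast
    from step[OF d] obtain z d' where z: "z \<in> Y" and d': "d' \<in> D"
      and eq': "x + d = z + d'" by blast
    define N where "N = real (Suc (Suc n))"
    have N: "0 < N" "real (Suc n) = N - 1" "1 \<le> N" by (simp_all add: N_def)
    define w where "w = ((N - 1) / N) *\<^sub>R y + (1 / N) *\<^sub>R z"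
    have "w \<in> Y"
      unfolding w_def using Y' y z N by (intro convexD) (auto simp: field_simps)
    have "N *\<^sub>R w = (N - 1) *\<^sub>R y + z"
      using N by (simp add: w_def scaleR_add_right)
    moreover have "N *\<^sub>R x + d\<^sub>0 = ((N - 1) *\<^sub>R x + d\<^sub>0) + x"
      by (simp add: scaleR_diff_left)
    ultimately have "N *\<^sub>R x + d\<^sub>0 = N *\<^sub>R w + d'"
      using eq eq' unfolding N(2) by (simp add: add.assoc add.commute[of d x])
    with \<open>w \<in> Y\<close> d' show ?case unfolding N_def by blast
  qed
  then obtain y d where y: "\<And>n. y n \<in> Y" and d: "\<And>n. d n \<in> D"
    and eq: "\<And>n. real (Suc n) *\<^sub>R x + d\<^sub>0 = real (Suc n) *\<^sub>R y n + d n" by metis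
  define t where "t n = inverse (real (Suc n))" for n
  have t: "0 < t n" "t n \<le> 1" "t n * real (Suc n) = 1" for n
    by (simp_all add: t_def divide_simps)
  have t0: "t \<longlonglongrightarrow> 0" unfolding t_def by (rule LIMSEQ_inverse_real_of_nat)
  have "x + t n *\<^sub>R d\<^sub>0 = y n + t n *\<^sub>R d n" for n
  proof -
    have "t n *\<^sub>R (real (Suc n) *\<^sub>R x + d\<^sub>0) = t n *\<^sub>R (real (Suc n) *\<^sub>R y n + d n)"
      by (simp only: eq)
    then show ?thesis
      by (simp only: scaleR_add_right scaleR_scaleR t(3) scaleR_one)
  qed
  then show "x \<in> Y" by (rule shrinking_displacement[OF V D Y d0 d y t(1,2) t0])
qed

text \<open>A limit of points \<open>a\<^sub>n + b\<^sub>n\<close> is again such a sum because the \<open>a\<^sub>n\<close> can be taken in a compact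
  slice.  If \<open>a + b + n v = a\<^sub>n + b\<^sub>n\<close> for all \<open>n\<close>, then \<open>v + b\<close> differs from the point
  \<open>(1 - 1/n) b + b\<^sub>n / n\<close> of \<open>B\<close> by the shrinking displacement \<open>(a\<^sub>n - a) / n\<close>, hence lies in \<open>B\<close>.\<close>

lemma convex_family_plus:
  fixes A B :: "(real ^ 'n) set"
  assumes V: "convex_cone V" and A: "A \<in> convex_family V" and B: "B \<in> convex_family V"
  shows "A + B \<in> convex_family V"
proof -
  have A': "closed A" "convex A" "recession_cone A = V" "A \<noteq> {}"
    and B': "closed B" "convex B" "recession_cone B = V" "B \<noteq> {}"
    using A B by (auto simp: convex_family_def)
  have "closed (A + B)"
    unfolding closed_sequential_limits
  proof (intro allI impI, elim conjE)
    fix s x assume s: "\<forall>n. s n \<in> A + B" and lim: "s \<longlonglongrightarrow> x"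
    have "\<exists>a. a \<in> slice V A B {s n}" for n
    proof -
      obtain a b where "a \<in> A" "b \<in> B" "s n = a + b"
        using s by (metis set_plus_elim)
      then show ?thesis using slice_nonempty[OF V A B] by metis
    qed
    then obtain a where a: "\<And>n. a n \<in> slice V A B {s n}" by metis
    then have "\<forall>n. a n \<in> slice V A B (insert x (range s))" by (auto simp: slice_def)
    then obtain l r where l: "l \<in> A" and r: "strict_mono r" and lim_a: "(a \<circ> r) \<longlonglongrightarrow> l"
      by (rule seq_compactE[OF compact_imp_seq_compact
            [OF compact_slice[OF A B compact_sequence_with_limit[OF lim]]]])
        (auto simp: slice_def)
    have lim_b: "(\<lambda>n. (s \<circ> r) n - (a \<circ> r) n) \<longlonglongrightarrow> x - l"
      by (intro tendsto_diff lim_a LIMSEQ_subseq_LIMSEQ[OF lim r])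
    have "(s \<circ> r) n - (a \<circ> r) n \<in> B" for n using a[of "r n"] by (simp add: slice_def)
    then have "x - l \<in> B" by (rule closed_sequentially[OF B'(1) _ lim_b])
    with l have "l + (x - l) \<in> A + B" by (rule set_plus_intro)
    then show "x \<in> A + B" by simp
  qed
  moreover have "recession_cone (A + B) = V"
  proof
    show "V \<subseteq> recession_cone (A + B)"
    proof
      fix v assume v: "v \<in> V"
      have "v + (a + b) \<in> A + B" if "a \<in> A" "b \<in> B" for a b
        using set_plus_intro[OF recession_coneD[of v A a] that(2)] that(1) v A'(3)
        by (simp add: add.assoc)
      then show "v \<in> recession_cone (A + B)"
        by (auto simp: recession_cone_def elim!: set_plus_elim)
    qed
  next
    show "recession_cone (A + B) \<subseteq> V"
    proof
      fix v assume v: "v \<in> recession_cone (A + B)"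
      obtain a where a: "a \<in> A" using A'(4) by blast
      have "v + b \<in> B" if b: "b \<in> B" for b
      proof -
        have "a + b + real n *\<^sub>R v \<in> A + B" for n
        proof (induction n)
          case (Suc n)
          from recession_coneD[OF v Suc.IH] show ?case by (simp add: algebra_simps)
        qed (use a b in auto)
        then have "\<exists>a'\<in>A. \<exists>b'\<in>B. a + b + real (Suc n) *\<^sub>R v = a' + b'" for n
          by (blast elim: set_plus_elim)
        then obtain a' b' where a': "\<And>n. a' n \<in> A" and b': "\<And>n. b' n \<in> B"
          and eq: "\<And>n. a + b + real (Suc n) *\<^sub>R v = a' n + b' n" by metis
        define t where "t n = inverse (real (Suc n))" for n
        have t: "0 < t n" "t n \<le> 1" "t n * real (Suc n) = 1" for n
          by (simp_all add: t_def divide_simps)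
        have t0: "t \<longlonglongrightarrow> 0" unfolding t_def by (rule LIMSEQ_inverse_real_of_nat)
        have y: "(1 - t n) *\<^sub>R b + t n *\<^sub>R b' n \<in> B" for n
          using B'(2) b b' t(2) less_imp_le[OF t(1)] by (intro convexD) auto
        have "v + b + t n *\<^sub>R a = ((1 - t n) *\<^sub>R b + t n *\<^sub>R b' n) + t n *\<^sub>R a' n" for n
        proof -
          have "t n *\<^sub>R (a + b + real (Suc n) *\<^sub>R v) = t n *\<^sub>R (a' n + b' n)"
            by (simp only: eq)
          then have "t n *\<^sub>R a + t n *\<^sub>R b + v = t n *\<^sub>R a' n + t n *\<^sub>R b' n"
            by (simp only: scaleR_add_right scaleR_scaleR t(3) scaleR_one)
          then show ?thesis by (simp add: algebra_simps)
        qed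
        then show ?thesis by (rule shrinking_displacement[OF V A B a a' y t(1,2) t0])
      qed
      then have "v \<in> recession_cone B" by (auto simp: recession_cone_def)
      then show "v \<in> V" by (simp add: B')
    qed
  qed
  moreover have "A + B \<noteq> {}" using A'(4) B'(4) by blast
  ultimately show ?thesis
    using A'(2) B'(2) by (simp add: convex_family_def convex_set_plus)
qed

section \<open>Sums with intersections of chains\<close>

text \<open>If \<open>x\<close> lies in every \<open>S + D\<close>, the slices \<open>S \<inter> (x - D) \<inter> L\<^sub>V\<^sup>\<bottom>\<close> form a chain of nonempty
  compact sets.  A common point \<open>s\<close> gives a decomposition \<open>x = s + (x - s)\<close> that works
  for all \<open>S\<close> at once.\<close>

lemma Inter_chain_plus:
  fixes \<F> :: "(real ^ 'n) set set"
  assumes V: "convex_cone V" and fam: "\<F> \<subseteq> convex_family V" and D: "D \<in> convex_family V"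
    and ne: "\<F> \<noteq> {}" and chain: "\<And>S T. S \<in> \<F> \<Longrightarrow> T \<in> \<F> \<Longrightarrow> S \<subseteq> T \<or> T \<subseteq> S"
  shows "\<Inter>\<F> + D = (\<Inter>S\<in>\<F>. S + D)"
proof
  show "\<Inter>\<F> + D \<subseteq> (\<Inter>S\<in>\<F>. S + D)"
    by (intro INT_greatest set_plus_mono2 Inter_lower order_refl)
next
  show "(\<Inter>S\<in>\<F>. S + D) \<subseteq> \<Inter>\<F> + D"
  proof
    fix x assume x: "x \<in> (\<Inter>S\<in>\<F>. S + D)"
    let ?\<K> = "(\<lambda>S. slice V S D {x}) ` \<F>"
    have "\<Inter>?\<K> \<noteq> {}"
    proof (rule compact_chain)
      show "compact K" if "K \<in> ?\<K>" for K
        using that fam D by (auto intro: compact_slice)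
      show "{} \<notin> ?\<K>"
      proof
        assume "{} \<in> ?\<K>"
        then obtain S where S: "S \<in> \<F>" "slice V S D {x} = {}" by auto
        from x S(1) have "x \<in> S + D" by blast
        then obtain s d where "s \<in> S" "d \<in> D" "x = s + d" by (rule set_plus_elim)
        with slice_nonempty[OF V _ D, of S s d] fam S show False by blast
      qed
      show "K \<subseteq> K' \<or> K' \<subseteq> K" if "K \<in> ?\<K> \<and> K' \<in> ?\<K>" for K K'
      proof -
        from that obtain S T where ST: "S \<in> \<F>" "T \<in> \<F>"
          "K = slice V S D {x}" "K' = slice V T D {x}" by auto
        from chain[OF ST(1,2)] show ?thesis unfolding ST(3,4) slice_def by blast
      qed
    qed
    then obtain s where s: "\<And>S. S \<in> \<F> \<Longrightarrow> s \<in> slice V S D {x}" by blast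
    then have "s \<in> \<Inter>\<F>" "x - s \<in> D" using ne by (auto simp: slice_def)
    then have "s + (x - s) \<in> \<Inter>\<F> + D" by (rule set_plus_intro)
    then show "x \<in> \<Inter>\<F> + D" by simp
  qed
qed

section \<open>Pairs and their classes\<close>

lemma mem_pair_class:
  "(C, D) \<in> pair_class V (A, B) \<longleftrightarrow>
     A \<in> convex_family V \<and> B \<in> convex_family V \<and> C \<in> convex_family V \<and> D \<in> convex_family V \<and>
     A + D = B + C"
  by (auto simp: pair_class_def pair_rel_def)

lemma zero_minimal_iff:
  "zero_minimal V P \<longleftrightarrow> P \<in> pair_class V P \<and> 0 \<in> snd P \<and>
     (\<forall>Q\<in>pair_class V P. 0 \<in> snd Q \<longrightarrow> Q \<le> P \<longrightarrow> Q = P)"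
proof -
  have *: "{(C, D). (C, D) \<in> pair_class V P \<and> 0 \<in> D} = {Q \<in> pair_class V P. 0 \<in> snd Q}"
    by auto
  show ?thesis unfolding zero_minimal_def Let_def * by blast
qed

lemma pair_class_refl:
  assumes "A \<in> convex_family V" and "B \<in> convex_family V"
  shows "(A, B) \<in> pair_class V (A, B)"
  using assms by (simp add: mem_pair_class add.commute)

text \<open>From \<open>A + D = B + C\<close> and \<open>C + F = D + E\<close> one gets \<open>(A + F) + D = (B + E) + D\<close>, and \<open>D\<close> can
  be cancelled because \<open>A + F\<close> and \<open>B + E\<close> belong to the family.\<close>

lemma pair_class_trans:
  fixes V :: "(real ^ 'n) set"
  assumes V: "convex_cone V" and "Q \<in> pair_class V P" and "R \<in> pair_class V Q"
  shows "R \<in> pair_class V P"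
proof -
  obtain A B C D E F where PQR: "P = (A, B)" "Q = (C, D)" "R = (E, F)" by (metis surj_pair)
  have fam: "A \<in> convex_family V" "B \<in> convex_family V" "D \<in> convex_family V"
      "E \<in> convex_family V" "F \<in> convex_family V"
    and eqs: "A + D = B + C" "C + F = D + E"
    using assms(2,3) by (simp_all add: PQR mem_pair_class)
  have "(A + F) + D = (A + D) + F" by (simp only: ac_simps)
  also have "\<dots> = B + (C + F)" by (simp only: eqs(1) ac_simps)
  also have "\<dots> = (B + E) + D" by (simp only: eqs(2) ac_simps)
  finally have eq: "(A + F) + D = (B + E) + D" .
  have "A + F = B + E"
  proof
    show "A + F \<subseteq> B + E"
      by (rule order_cancellation[OF V fam(3) convex_family_plus[OF V fam(2,4)]])
        (simp only: eq order_refl)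
    show "B + E \<subseteq> A + F"
      by (rule order_cancellation[OF V fam(3) convex_family_plus[OF V fam(1,5)]])
        (simp only: eq order_refl)
  qed
  with fam show ?thesis by (simp add: PQR mem_pair_class)
qed

lemma translate_pair_in_class:
  fixes A B :: "(real ^ 'n) set"
  assumes "A \<in> convex_family V" and "B \<in> convex_family V"
  shows "translate_pair x (A, B) \<in> pair_class V (A, B)"
proof -
  have "S + (\<lambda>a. a - x) ` T = (\<lambda>a. a - x) ` (S + T)" for S T :: "(real ^ 'n) set"
    by (force simp: set_plus_def image_iff algebra_simps)
  then have "A + (\<lambda>b. b - x) ` B = B + (\<lambda>a. a - x) ` A" by (simp add: add.commute)
  then show ?thesis
    using assms by (simp add: translate_pair_def mem_pair_class convex_family_translate)
qed

text \<open>For a chain of pairs \<open>(C\<^sub>i, D\<^sub>i)\<close> of the class, \<open>A + \<Inter> D\<^sub>i = \<Inter> (A + D\<^sub>i) = \<Inter> (B + C\<^sub>i)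
  = B + \<Inter> C\<^sub>i\<close>.  As \<open>0 \<in> \<Inter> D\<^sub>i\<close>, the left-hand side is nonempty, and so \<open>\<Inter> C\<^sub>i\<close> is nonempty
  as well.\<close>

lemma chain_lower_bound:
  fixes V :: "(real ^ 'n) set"
  assumes V: "convex_cone V"
    and cls: "\<C> \<subseteq> pair_class V (A, B)" and ne: "\<C> \<noteq> {}" and zero: "\<And>Q. Q \<in> \<C> \<Longrightarrow> 0 \<in> snd Q"
    and chain: "\<And>Q R. Q \<in> \<C> \<Longrightarrow> R \<in> \<C> \<Longrightarrow> Q \<le> R \<or> R \<le> Q"
  shows "(\<Inter>(fst ` \<C>), \<Inter>(snd ` \<C>)) \<in> pair_class V (A, B)"
proof -
  have mem: "A \<in> convex_family V" "B \<in> convex_family V"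
      "fst Q \<in> convex_family V" "snd Q \<in> convex_family V" "A + snd Q = B + fst Q"
    if "Q \<in> \<C>" for Q
    using that cls mem_pair_class[of "fst Q" "snd Q" V A B] by auto
  have AB: "A \<in> convex_family V" "B \<in> convex_family V" using mem ne by blast+
  have chains: "S \<subseteq> T \<or> T \<subseteq> S" if "S \<in> p ` \<C>" "T \<in> p ` \<C>" "p = fst \<or> p = snd" for S T p
  proof -
    from that(1,2) obtain Q R where QR: "Q \<in> \<C>" "R \<in> \<C>" "S = p Q" "T = p R" by blast
    from chain[OF QR(1,2)] that(3) show ?thesis unfolding QR(3,4) less_eq_prod_def by blast
  qed
  have fams: "fst ` \<C> \<subseteq> convex_family V" "snd ` \<C> \<subseteq> convex_family V" using mem by auto
  have "\<Inter>(snd ` \<C>) \<noteq> {}" using zero by blast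
  then have D: "\<Inter>(snd ` \<C>) \<in> convex_family V"
    using fams(2) ne by (intro Inter_in_convex_family) auto
  have "A + \<Inter>(snd ` \<C>) = (\<Inter>S\<in>snd ` \<C>. S + A)"
    unfolding add.commute[of A]
    by (rule Inter_chain_plus[OF V fams(2) AB(1)]) (use ne chains in auto)
  also have "\<dots> = (\<Inter>Q\<in>\<C>. A + snd Q)" by (simp add: image_image add.commute)
  also have "\<dots> = (\<Inter>Q\<in>\<C>. B + fst Q)" using mem(5) by simp
  also have "\<dots> = (\<Inter>S\<in>fst ` \<C>. S + B)" by (simp add: image_image add.commute)
  also have "\<dots> = B + \<Inter>(fst ` \<C>)"
    unfolding add.commute[of B]
    by (rule Inter_chain_plus[OF V fams(1) AB(2), symmetric]) (use ne chains in auto)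
  finally have eq: "A + \<Inter>(snd ` \<C>) = B + \<Inter>(fst ` \<C>)" .
  have "A + \<Inter>(snd ` \<C>) \<in> convex_family V" by (rule convex_family_plus[OF V AB(1) D])
  then have "B + \<Inter>(fst ` \<C>) \<noteq> {}" by (simp add: eq convex_family_def)
  then have "\<Inter>(fst ` \<C>) \<noteq> {}" by (metis sumset_empty(1))
  then have "\<Inter>(fst ` \<C>) \<in> convex_family V"
    using fams(1) ne by (intro Inter_in_convex_family) auto
  with D AB eq show ?thesis by (simp add: mem_pair_class)
qed

text \<open>Zorn's lemma gives a \<open>Q\<close> minimal among the pairs below \<open>P\<close> in the class of \<open>P\<close>, whereas
  \<open>0\<close>-minimality of \<open>Q\<close> speaks of the class of \<open>Q\<close>; transitivity identifies the two.\<close>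

lemma exists_zero_minimal:
  fixes V :: "(real ^ 'n) set"
  assumes V: "convex_cone V" and P: "P \<in> pair_class V P" "0 \<in> snd P"
  obtains Q where "Q \<in> pair_class V P" "zero_minimal V Q" "Q \<le> P"
proof -
  let ?S = "{Q \<in> pair_class V P. 0 \<in> snd Q \<and> Q \<le> P}"
  have "\<exists>m\<in>?S. \<forall>a\<in>?S. a \<le> m \<longrightarrow> a = m"
  proof (rule predicate_Zorn)
    show "partial_order_on ?S (relation_of (\<lambda>x y. y \<le> x) ?S)"
      by (rule partial_order_on_relation_ofI) auto
    fix \<C> assume "\<C> \<in> Chains (relation_of (\<lambda>x y. y \<le> x) ?S)"
    then have sub: "\<C> \<subseteq> ?S" and chain: "\<And>Q R. Q \<in> \<C> \<Longrightarrow> R \<in> \<C> \<Longrightarrow> Q \<le> R \<or> R \<le> Q"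
      by (auto simp: Chains_def relation_of_def)
    show "\<exists>u\<in>?S. \<forall>a\<in>\<C>. u \<le> a"
    proof (cases "\<C> = {}")
      case True
      then show ?thesis using P by (intro bexI[of _ P]) auto
    next
      case False
      let ?u = "(\<Inter>(fst ` \<C>), \<Inter>(snd ` \<C>))"
      have le: "?u \<le> Q" if "Q \<in> \<C>" for Q using that by (auto simp: less_eq_prod_def)
      obtain Q where Q: "Q \<in> \<C>" using False by blast
      have "?u \<in> pair_class V (fst P, snd P)"
        using sub by (intro chain_lower_bound[OF V _ False _ chain]) auto
      moreover have "0 \<in> snd ?u" using sub by auto
      moreover have "?u \<le> P" using le[OF Q] Q sub by (auto intro: order_trans)
      ultimately show ?thesis using le by (intro bexI[of _ ?u]) auto
    qed
  qed
  then obtain Q where Q: "Q \<in> pair_class V P" "0 \<in> snd Q" "Q \<le> P"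
    and min: "\<And>R. R \<in> pair_class V P \<Longrightarrow> 0 \<in> snd R \<Longrightarrow> R \<le> P \<Longrightarrow> R \<le> Q \<Longrightarrow> R = Q"
    by blast
  have "Q \<in> pair_class V Q"
    using Q(1) by (cases P, cases Q) (auto simp: mem_pair_class add.commute)
  then have "zero_minimal V Q"
    unfolding zero_minimal_iff using Q min pair_class_trans[OF V Q(1)]
    by (auto intro: order_trans)
  with Q that show thesis by blast
qed

section \<open>The kernel of minimality\<close>

theorem proposition2p6:
  fixes V A B :: "(real ^ 'n) set"
  assumes "closed V" and "convex_cone V"
    and "(A, B) \<in> convex_family V \<times> convex_family V"
    and "zero_minimal V (A, B)"
    and "translation_property V (A, B)"
  shows "({translate_pair x (A, B) | x. x \<in> minimality_kernel V (A, B)}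
           = {Q \<in> pair_class V (A, B). zero_minimal V Q})
    \<and> (\<forall>x\<in>B. x \<in> minimality_kernel V (A, B)
           \<longleftrightarrow> B \<inter> (\<lambda>v. x - v) ` V = (\<lambda>l. x + l) ` lineality_space V)
    \<and> B = minimality_kernel V (A, B) + V"
proof (intro conjI)
  note V = assms(2) and transl = assms(5)[unfolded translation_property_def]
  have A: "A \<in> convex_family V" and B: "B \<in> convex_family V" using assms(3) by auto
  have rec: "recession_cone A = V" "recession_cone B = V"
    using A B by (auto simp: convex_family_def)
  have self: "(A, B) \<in> pair_class V (A, B)" by (rule pair_class_refl[OF A B])
  have kernelI: "x \<in> minimality_kernel V (A, B)" if "zero_minimal V (translate_pair x (A, B))" for x
    using that by (auto simp: minimality_kernel_def zero_minimal_iff translate_pair_def)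
  have translate: "\<exists>x. Q = translate_pair x (A, B)"
    if "Q \<in> pair_class V (A, B)" "zero_minimal V Q" for Q
    using transl self that assms(4) by blast

  show "{translate_pair x (A, B) | x. x \<in> minimality_kernel V (A, B)}
      = {Q \<in> pair_class V (A, B). zero_minimal V Q}"
  proof
    show "{translate_pair x (A, B) | x. x \<in> minimality_kernel V (A, B)}
        \<subseteq> {Q \<in> pair_class V (A, B). zero_minimal V Q}"
      using translate_pair_in_class[OF A B] by (auto simp: minimality_kernel_def)
    show "{Q \<in> pair_class V (A, B). zero_minimal V Q}
        \<subseteq> {translate_pair x (A, B) | x. x \<in> minimality_kernel V (A, B)}"
      using translate kernelI by blast
  qed

  \<comment> \<open>A minimal pair below \<open>(A - x, B - x)\<close> is \<open>(A - y, B - y)\<close> with \<open>B + (x - y) \<subseteq> B\<close>.\<close>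
  have decomp: "\<exists>y\<in>minimality_kernel V (A, B). x - y \<in> V" if x: "x \<in> B" for x
  proof -
    let ?P = "translate_pair x (A, B)"
    have P: "?P \<in> pair_class V (A, B)" by (rule translate_pair_in_class[OF A B])
    have "?P \<in> pair_class V ?P"
      using A B by (simp add: translate_pair_def pair_class_refl convex_family_translate)
    moreover have "0 \<in> snd ?P" using x by (force simp: translate_pair_def)
    ultimately obtain Q where Q: "Q \<in> pair_class V ?P" "zero_minimal V Q" "Q \<le> ?P"
      by (rule exists_zero_minimal[OF V])
    obtain y where y: "Q = translate_pair y (A, B)"
      using translate[OF pair_class_trans[OF V P Q(1)] Q(2)] by blast
    have sub: "(\<lambda>b. b - y) ` B \<subseteq> (\<lambda>b. b - x) ` B"
      using Q(3) by (simp add: y translate_pair_def)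
    have "(x - y) + b \<in> B" if "b \<in> B" for b
    proof -
      from sub that have "b - y \<in> (\<lambda>b. b - x) ` B" by blast
      then obtain b' where "b' \<in> B" "b - y = b' - x" by blast
      then show ?thesis by (simp add: algebra_simps)
    qed
    then have "x - y \<in> V" using rec(2) by (auto simp: recession_cone_def)
    moreover have "y \<in> minimality_kernel V (A, B)" using Q(2) y kernelI by simp
    ultimately show ?thesis by blast
  qed

  have kernel_sub: "minimality_kernel V (A, B) \<subseteq> B" by (auto simp: minimality_kernel_def)
  show "B = minimality_kernel V (A, B) + V"
  proof
    show "B \<subseteq> minimality_kernel V (A, B) + V"
    proof
      fix x assume "x \<in> B"
      from decomp[OF this] obtain y where "y \<in> minimality_kernel V (A, B)" "x - y \<in> V" by blast
      then have "y + (x - y) \<in> minimality_kernel V (A, B) + V" by (rule set_plus_intro)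
      then show "x \<in> minimality_kernel V (A, B) + V" by simp
    qed
    show "minimality_kernel V (A, B) + V \<subseteq> B"
    proof
      fix x assume "x \<in> minimality_kernel V (A, B) + V"
      then obtain y v where "y \<in> minimality_kernel V (A, B)" "v \<in> V" "x = y + v"
        by (rule set_plus_elim)
      then show "x \<in> B"
        using recession_coneD[of v B y] rec(2) kernel_sub by (auto simp: add.commute)
    qed
  qed

  show "\<forall>x\<in>B. x \<in> minimality_kernel V (A, B)
      \<longleftrightarrow> B \<inter> (\<lambda>v. x - v) ` V = (\<lambda>l. x + l) ` lineality_space V"
  proof (intro ballI iffI)
    fix x assume x: "x \<in> B" and ker: "x \<in> minimality_kernel V (A, B)"
    show "B \<inter> (\<lambda>v. x - v) ` V = (\<lambda>l. x + l) ` lineality_space V"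
    proof
      show "(\<lambda>l. x + l) ` lineality_space V \<subseteq> B \<inter> (\<lambda>v. x - v) ` V"
      proof (rule image_subsetI)
        fix l assume "l \<in> lineality_space V"
        then have l: "l \<in> V" "- l \<in> V" by (rule lineality_spaceD)+
        have "x + l \<in> B" using recession_coneD[of l B x] l(1) rec(2) x by (simp add: add.commute)
        moreover have "x + l = x - (- l)" by simp
        ultimately show "x + l \<in> B \<inter> (\<lambda>v. x - v) ` V" using l(2) by blast
      qed
      show "B \<inter> (\<lambda>v. x - v) ` V \<subseteq> (\<lambda>l. x + l) ` lineality_space V"
      proof
        fix y assume "y \<in> B \<inter> (\<lambda>v. x - v) ` V"
        then obtain v where v: "v \<in> V" "y = x - v" "y \<in> B" by blast
        \<comment> \<open>Translating by \<open>y\<close> instead of \<open>x\<close> moves both sets by \<open>v\<close>, hence into themselves.\<close>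
        have le_set: "(\<lambda>a. a - y) ` S \<subseteq> (\<lambda>a. a - x) ` S" if "recession_cone S = V" for S
        proof (rule image_subsetI)
          fix a assume "a \<in> S"
          then have "v + a \<in> S" using that v(1) recession_coneD by blast
          moreover have "a - y = (v + a) - x" using v(2) by simp
          ultimately show "a - y \<in> (\<lambda>a. a - x) ` S" by blast
        qed
        then have "translate_pair y (A, B) \<le> translate_pair x (A, B)"
          using rec by (simp add: translate_pair_def)
        moreover have "0 \<in> snd (translate_pair y (A, B))"
          using v(3) by (force simp: translate_pair_def)
        moreover have "translate_pair y (A, B) \<in> pair_class V (translate_pair x (A, B))"
        proof (rule pair_class_trans[OF V _ translate_pair_in_class[OF A B]])
          show "(A, B) \<in> pair_class V (translate_pair x (A, B))"
            using translate_pair_in_class[OF A B, of x]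
            by (simp add: translate_pair_def mem_pair_class add.commute)
        qed
        ultimately have "translate_pair y (A, B) = translate_pair x (A, B)"
          using ker by (simp add: minimality_kernel_def zero_minimal_iff)
        then have eq: "(\<lambda>b. b - y) ` B = (\<lambda>b. b - x) ` B" by (simp add: translate_pair_def)
        have "- v + b \<in> B" if "b \<in> B" for b
        proof -
          from eq that have "b - x \<in> (\<lambda>b. b - y) ` B" by blast
          then obtain b' where "b' \<in> B" "b - x = b' - y" by blast
          then show ?thesis using v(2) by (simp add: algebra_simps)
        qed
        then have "- v \<in> V" using rec(2) by (auto simp: recession_cone_def)
        then have "- v \<in> lineality_space V" using v(1) by (simp add: lineality_space_def)
        then show "y \<in> (\<lambda>l. x + l) ` lineality_space V" using v(2) by force
      qed
    qed
  next
    fix x assume x: "x \<in> B" and eq: "B \<inter> (\<lambda>v. x - v) ` V = (\<lambda>l. x + l) ` lineality_space V"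
    obtain y where y: "y \<in> minimality_kernel V (A, B)" "x - y \<in> V" using decomp[OF x] by blast
    have "y = x - (x - y)" by simp
    with y kernel_sub have "y \<in> B \<inter> (\<lambda>v. x - v) ` V" by blast
    then have "y \<in> (\<lambda>l. x + l) ` lineality_space V" using eq by simp
    then obtain l where l: "l \<in> lineality_space V" "y = x + l" by blast
    have inv: "(\<lambda>a. a - y) ` S = (\<lambda>a. a - x) ` S" if "recession_cone S = V" for S
    proof -
      have "- l + a \<in> S" "l + a \<in> S" if "a \<in> S" for a
        using lineality_spaceD[OF l(1)] \<open>recession_cone S = V\<close> that recession_coneD by blast+
      moreover have "a - y = (- l + a) - x" "a - x = (l + a) - y" for a using l(2) by simp_all
      ultimately show ?thesis by blast
    qed
    have "translate_pair y (A, B) = translate_pair x (A, B)"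
      using inv rec by (simp add: translate_pair_def)
    then show "x \<in> minimality_kernel V (A, B)"
      using y(1) x by (simp add: minimality_kernel_def)
  qed
qed

end
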